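(* Let $X$ be a path connected topological space, $x\in X$, and let $H$ be a subgroup of $\pi_1(X,x)$. Then $\pi_H^{qs}(X,x)$ is a subgroup of $\pi_1(X,x)$. If moreover $H$ is a normal subgroup of $\pi_1(X,x)$, then $\pi_H^{qs}(X,x)$ is a normal subgroup of $\pi_1(X,x)$. In particular, $\pi_1^{qs}(X,x)$ is a normal subgroup of $\pi_1(X,x)$.
   Context: All spaces are assumed path connected. $I=[0,1]$, $\dot I=\{0,1\}$; $\simeq$ rel $\dot I$ denotes homotopy of paths relative to endpoints, and $[f]$ is the homotopy class of a path $f$ rel $\dot I$. $c_x$ is the constant path at $x$. Closeness: let $f,g:I\to X$ be paths with $f(0)=g(0)$ and $f(1)=g(1)$. We say $f$ is homotopically close to $g$ rel $\dot I$ (written $f\xrightarrow{close} g$ rel $\dot I$) if for every partition $0=t_0<t_1<\cdots<t_n=1$ and every sequence of open sets $U_1,\ldots,U_n$ of $X$ with $g([t_{i-1},t_i])\subset U_i$ for all $i$, there is a path $\gamma$ with $\gamma([t_{i-1},t_i])\subset U_i$ for $1\le i\le n$, $\gamma(t_i)=g(t_i)$ for $0\le i\le n$, and $\gamma\simeq f$ rel $\dot I$. For a subset $H\subseteq\pi_1(X,x)$, $\pi_H^{qs}(X,x)=\{[f]\in\pi_1(X,x) : f\xrightarrow{close} h \text{ rel } \dot I \text{ for some loop } h \text{ at } x \text{ with } [h]\in H\}$. For $H=\{[c_x]\}$ the trivial subgroup, write $\pi_1^{qs}(X,x)$ (the quasi-small loop group). *)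

theory Defs
  imports "HOL-Analysis.Analysis" "HOL-Algebra.Coset"
begin

text \<open>
  Paths in an abstract topology \<open>X\<close> are total functions on the reals satisfying \<^const>\<open>pathin\<close>;
  only their values on \<open>[0,1]\<close> matter. The library's \<^const>\<open>homotopic_paths\<close> and
  \<^const>\<open>joinpaths\<close> are tied to the class \<^class>\<open>topological_space\<close>; the first two definitions
  are their counterparts for a topology given as a value.
\<close>

definition homotopic_rel_ends :: "'a topology \<Rightarrow> (real \<Rightarrow> 'a) \<Rightarrow> (real \<Rightarrow> 'a) \<Rightarrow> bool"
  where "homotopic_rel_ends X f g \<longleftrightarrow>
    homotopic_with (\<lambda>r. r 0 = f 0 \<and> r 1 = f 1) (top_of_set {0..1}) X f g"

definition path_concat :: "(real \<Rightarrow> 'a) \<Rightarrow> (real \<Rightarrow> 'a) \<Rightarrow> real \<Rightarrow> 'a"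
  where "path_concat f g = (\<lambda>t. if t \<le> 1/2 then f (2 * t) else g (2 * t - 1))"

definition path_class :: "'a topology \<Rightarrow> (real \<Rightarrow> 'a) \<Rightarrow> (real \<Rightarrow> 'a) set"
  where "path_class X f = {g. homotopic_rel_ends X f g}"

definition loop_at :: "'a topology \<Rightarrow> 'a \<Rightarrow> (real \<Rightarrow> 'a) \<Rightarrow> bool"
  where "loop_at X x f \<longleftrightarrow> pathin X f \<and> f 0 = x \<and> f 1 = x"

text \<open>
  The product of two classes is the union of the classes of all concatenations of
  representatives, which is again a single class because concatenation respects homotopy.
\<close>

definition fundamental_group :: "'a topology \<Rightarrow> 'a \<Rightarrow> (real \<Rightarrow> 'a) set monoid"
  where "fundamental_group X x =
    \<lparr>carrier = {path_class X f | f. loop_at X x f},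
     mult = (\<lambda>a b. \<Union>f\<in>a. \<Union>g\<in>b. path_class X (path_concat f g)),
     one = path_class X (\<lambda>_. x)\<rparr>"

definition homotopically_close :: "'a topology \<Rightarrow> (real \<Rightarrow> 'a) \<Rightarrow> (real \<Rightarrow> 'a) \<Rightarrow> bool"
  where "homotopically_close X f g \<longleftrightarrow>
    pathin X f \<and> pathin X g \<and> f 0 = g 0 \<and> f 1 = g 1 \<and>
    (\<forall>(n::nat) (t::nat \<Rightarrow> real) (U::nat \<Rightarrow> 'a set).
       t 0 = 0 \<and> t n = 1 \<and> (\<forall>i\<in>{1..n}. t (i - 1) < t i) \<and>
       (\<forall>i\<in>{1..n}. openin X (U i) \<and> g ` {t (i - 1)..t i} \<subseteq> U i)
       \<longrightarrow> (\<exists>\<gamma>. pathin X \<gamma> \<and>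
              (\<forall>i\<in>{1..n}. \<gamma> ` {t (i - 1)..t i} \<subseteq> U i) \<and>
              (\<forall>i\<in>{0..n}. \<gamma> (t i) = g (t i)) \<and>
              homotopic_rel_ends X \<gamma> f))"

definition qs_subset :: "'a topology \<Rightarrow> 'a \<Rightarrow> (real \<Rightarrow> 'a) set set \<Rightarrow> (real \<Rightarrow> 'a) set set"
  where "qs_subset X x H =
    {path_class X f | f. loop_at X x f \<and>
       (\<exists>h. loop_at X x h \<and> path_class X h \<in> H \<and> homotopically_close X f h)}"

definition quasi_small_loop_group :: "'a topology \<Rightarrow> 'a \<Rightarrow> (real \<Rightarrow> 'a) set set"
  where "quasi_small_loop_group X x = qs_subset X x {path_class X (\<lambda>_. x)}"

end

theory Submission
  imports Defs
begin

text \<open>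
  Closeness is compatible with concatenation and with reversal of paths
  (\<open>homotopically_close_path_concat\<close>, \<open>homotopically_close_path_reverse\<close>), and every path is
  close to itself. These three facts carry the whole argument. If \<open>f\<close> is close to \<open>h\<close> and \<open>f'\<close> is
  close to \<open>h'\<close>, where the classes of \<open>h\<close> and \<open>h'\<close> lie in \<open>H\<close>, then \<open>f\<close> followed by \<open>f'\<close> is close
  to \<open>h\<close> followed by \<open>h'\<close>, and the reverse of \<open>f\<close> is close to the reverse of \<open>h\<close>; the comparison
  loops again represent elements of \<open>H\<close>. If \<open>H\<close> is normal, then for any loop \<open>k\<close> the conjugate
  \<open>k f k\<inverse>\<close> is close to \<open>k h k\<inverse>\<close>, because \<open>k\<close> is close to itself, and the class of
  \<open>k h k\<inverse>\<close> stays in \<open>H\<close>. The quasi-small loop group is the case of the trivial subgroup.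

  The compatibility with concatenation is awkward to read off from the definition, since a partition
  of the unit interval need not contain \<open>1/2\<close> and does not restrict to partitions of the two
  halves. The remedy is an equivalent form of closeness
  (\<open>homotopically_close_iff_constraints\<close>) that replaces a partition by finitely many unrelated
  requirements: pass through prescribed points at prescribed times, and stay inside an
  open set during a prescribed interval. Such a family can be pulled back along \<open>t \<mapsto> 2 t\<close>,
  \<open>t \<mapsto> 2 t - 1\<close> or \<open>t \<mapsto> 1 - t\<close> one requirement at a time.

  That the homotopy classes form a group follows from \<open>reparametrizations_homotopic\<close>, once
  the product is known to be well defined: the two sides of each group law are represented by
  reparametrizations of a single path.
\<close>

section \<open>Homotopy of paths in a topology given as a value\<close>

abbreviation path_reverse :: "(real \<Rightarrow> 'a) \<Rightarrow> real \<Rightarrow> 'a"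
  where "path_reverse f \<equiv> f \<circ> (\<lambda>t. 1 - t)"

lemma homotopic_rel_ends_imp:
  assumes "homotopic_rel_ends X f g"
  shows "pathin X f" "pathin X g" "g 0 = f 0" "g 1 = f 1"
  using assms homotopic_with_imp_continuous_maps[of _ _ X f g] homotopic_with_imp_property[of _ _ X f g]
  unfolding homotopic_rel_ends_def pathin_def by blast+

lemma homotopic_rel_ends_refl: "pathin X f \<Longrightarrow> homotopic_rel_ends X f f"
  by (simp add: homotopic_rel_ends_def pathin_def)

lemma homotopic_rel_ends_sym:
  assumes "homotopic_rel_ends X f g"
  shows "homotopic_rel_ends X g f"
  using homotopic_with_symD[OF assms[unfolded homotopic_rel_ends_def]]
    homotopic_rel_ends_imp[OF assms]
  by (simp add: homotopic_rel_ends_def)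

lemma homotopic_rel_ends_trans:
  assumes "homotopic_rel_ends X f g" "homotopic_rel_ends X g h"
  shows "homotopic_rel_ends X f h"
  using assms homotopic_rel_ends_imp[OF assms(1)] homotopic_with_trans
  unfolding homotopic_rel_ends_def by fastforce

lemma homotopic_rel_ends_eq:
  assumes "pathin X f" "\<And>t. t \<in> {0..1} \<Longrightarrow> f t = g t"
  shows "homotopic_rel_ends X f g"
  unfolding homotopic_rel_ends_def
  by (rule homotopic_with_equal) (use assms in \<open>auto simp: pathin_def\<close>)

lemma path_class_eq_iff:
  assumes "pathin X f"
  shows "path_class X f = path_class X g \<longleftrightarrow> homotopic_rel_ends X f g"
proof
  assume "path_class X f = path_class X g"
  then have "homotopic_rel_ends X g f"
    using homotopic_rel_ends_refl[OF assms] by (auto simp: path_class_def)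
  then show "homotopic_rel_ends X f g"
    by (rule homotopic_rel_ends_sym)
next
  assume "homotopic_rel_ends X f g"
  then show "path_class X f = path_class X g"
    unfolding path_class_def
    by (blast intro: homotopic_rel_ends_trans homotopic_rel_ends_sym)
qed

text \<open>
  The straight-line homotopy from \<open>\<phi>\<close> to \<open>\<psi>\<close> stays in the convex set \<open>[0,1]\<close>, and \<open>f\<close> carries it
  to \<open>X\<close>. Since \<open>\<phi>\<close> and \<open>\<psi>\<close> may have any common end points, this covers the contraction of a path
  followed back and forth as well as changes of speed.
\<close>

lemma reparametrizations_homotopic:
  assumes f: "pathin X f"
    and \<phi>: "path \<phi>" "path_image \<phi> \<subseteq> {0..1::real}" and \<psi>: "path \<psi>" "path_image \<psi> \<subseteq> {0..1}"
    and ends: "\<phi> 0 = \<psi> 0" "\<phi> 1 = \<psi> 1"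
  shows "homotopic_rel_ends X (f \<circ> \<phi>) (f \<circ> \<psi>)"
proof -
  have "homotopic_paths {0..1} \<phi> \<psi>"
  proof (rule homotopic_paths_linear)
    fix t :: real assume "t \<in> {0..1}"
    then have "\<phi> t \<in> {0..1}" "\<psi> t \<in> {0..1}"
      using \<phi>(2) \<psi>(2) unfolding path_image_def by blast+
    then show "closed_segment (\<phi> t) (\<psi> t) \<subseteq> {0..1}"
      by (intro closed_segment_subset) auto
  qed (use \<phi> \<psi> ends in \<open>auto simp: pathstart_def pathfinish_def\<close>)
  then have "homotopic_with (\<lambda>r. r 0 = \<phi> 0 \<and> r 1 = \<phi> 1) (top_of_set {0..1}) (top_of_set {0..1}) \<phi> \<psi>"
    by (simp add: homotopic_paths_def pathstart_def pathfinish_def)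
  then show ?thesis
    unfolding homotopic_rel_ends_def
    by (rule homotopic_with_compose_continuous_map_left) (use f in \<open>auto simp: pathin_def\<close>)
qed

lemma pathin_reparametrization:
  assumes "pathin X f" "path \<phi>" "path_image \<phi> \<subseteq> {0..1::real}"
  shows "pathin X (f \<circ> \<phi>)"
  using homotopic_rel_ends_imp(1) reparametrizations_homotopic[OF assms assms(2,3)] by blast

lemma path_reverse_image: "path (\<lambda>t::real. 1 - t)" "path_image (\<lambda>t::real. 1 - t) \<subseteq> {0..1}"
  by (auto simp: path_def path_image_def intro!: continuous_intros)

lemma pathin_path_reverse: "pathin X f \<Longrightarrow> pathin X (path_reverse f)"
  by (rule pathin_reparametrization) (use path_reverse_image in auto)

lemma homotopic_rel_ends_path_reverse:
  assumes "homotopic_rel_ends X f g"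
  shows "homotopic_rel_ends X (path_reverse f) (path_reverse g)"
  unfolding homotopic_rel_ends_def
proof (rule homotopic_with_compose_continuous_map_right)
  show "homotopic_with (\<lambda>r. r 0 = f 0 \<and> r 1 = f 1) (top_of_set {0..1}) X f g"
    using assms by (simp add: homotopic_rel_ends_def)
  show "continuous_map (top_of_set {0..1}) (top_of_set {0..1}) (\<lambda>t::real. 1 - t)"
    using path_reverse_image by (auto simp: path_def path_image_def)
qed auto

text \<open>
  The two homotopies are placed side by side over the halves of the time interval. They agree on
  the seam because each of them keeps its end points fixed.
\<close>

lemma homotopic_rel_ends_path_concat:
  assumes f: "homotopic_rel_ends X f f'" and g: "homotopic_rel_ends X g g'" and fg: "f 1 = g 0"
  shows "homotopic_rel_ends X (path_concat f g) (path_concat f' g')"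
proof -
  let ?I = "top_of_set {0..1::real}"
  obtain h where h: "continuous_map (prod_topology ?I ?I) X h"
      "\<And>x. h (0, x) = f x" "\<And>x. h (1, x) = f' x"
      "\<And>t. t \<in> {0..1} \<Longrightarrow> h (t, 0) = f 0 \<and> h (t, 1) = f 1"
    using f by (auto simp: homotopic_rel_ends_def homotopic_with_def)
  obtain k where k: "continuous_map (prod_topology ?I ?I) X k"
      "\<And>x. k (0, x) = g x" "\<And>x. k (1, x) = g' x"
      "\<And>t. t \<in> {0..1} \<Longrightarrow> k (t, 0) = g 0 \<and> k (t, 1) = g 1"
    using g by (auto simp: homotopic_rel_ends_def homotopic_with_def)
  let ?m = "\<lambda>z::real\<times>real. if snd z \<le> 1/2 then (h \<circ> (\<lambda>z. (fst z, 2 * snd z))) z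
                                         else (k \<circ> (\<lambda>z. (fst z, 2 * snd z - 1))) z"
  have sq: "prod_topology ?I ?I = top_of_set ({0..1} \<times> {0..1})"
    by (metis prod_topology_subtopology_eu)
  have "continuous_map (prod_topology ?I ?I) X ?m"
  proof (rule continuous_map_cases_le)
    show "continuous_map (subtopology (prod_topology ?I ?I)
        {z \<in> topspace (prod_topology ?I ?I). snd z \<le> 1/2}) X (h \<circ> (\<lambda>z. (fst z, 2 * snd z)))"
      by (rule continuous_map_compose[OF _ h(1)])
        (auto simp: sq subtopology_subtopology intro!: continuous_intros)
    show "continuous_map (subtopology (prod_topology ?I ?I)
        {z \<in> topspace (prod_topology ?I ?I). 1/2 \<le> snd z}) X (k \<circ> (\<lambda>z. (fst z, 2 * snd z - 1)))"
      by (rule continuous_map_compose[OF _ k(1)])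
        (auto simp: sq subtopology_subtopology intro!: continuous_intros)
    show "(h \<circ> (\<lambda>z. (fst z, 2 * snd z))) z = (k \<circ> (\<lambda>z. (fst z, 2 * snd z - 1))) z"
      if "z \<in> topspace (prod_topology ?I ?I)" "snd z = 1/2" for z
    proof -
      have "snd z = 1 / 2" "2 * snd z = 1" "2 * snd z - 1 = 0" "fst z \<in> {0..1}"
        using that by auto
      then show ?thesis using h(4) k(4) fg by simp
    qed
  qed (auto simp: sq intro!: continuous_intros)
  then show ?thesis
    unfolding homotopic_rel_ends_def homotopic_with_def
    by (rule_tac exI[of _ ?m]) (use h k in \<open>auto simp: path_concat_def\<close>)
qed

lemma pathin_path_concat:
  assumes "pathin X f" "pathin X g" "f 1 = g 0"
  shows "pathin X (path_concat f g)"
  using assms homotopic_rel_ends_imp(1) homotopic_rel_ends_path_concat homotopic_rel_ends_refl by metis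

section \<open>The fundamental group\<close>

text \<open>
  The two bracketings run through the same three paths on the subdivisions \<open>1/4, 1/2\<close> and
  \<open>1/2, 3/4\<close>. The piecewise linear map between these subdivisions has decreasing slopes \<open>2\<close>, \<open>1\<close>,
  \<open>1/2\<close>; being concave, it is the minimum of its three linear pieces.
\<close>

lemma path_concat_assoc:
  assumes "pathin X f" "pathin X g" "pathin X h" "f 1 = g 0" "g 1 = h 0"
  shows "homotopic_rel_ends X (path_concat (path_concat f g) h) (path_concat f (path_concat g h))"
proof -
  let ?k = "path_concat f (path_concat g h)"
  let ?\<phi> = "\<lambda>t::real. min (min (2 * t) (t + 1/4)) (t / 2 + 1/2)"
  have k: "pathin X ?k"
    using assms by (intro pathin_path_concat) (auto simp: path_concat_def)
  have "path_concat (path_concat f g) h = ?k \<circ> ?\<phi>"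
  proof
    fix t :: real
    consider "t \<le> 1/4" | "1/4 < t" "t \<le> 1/2" | "1/2 < t" by linarith
    then show "path_concat (path_concat f g) h t = (?k \<circ> ?\<phi>) t"
    proof cases
      case 1
      then have "?\<phi> t = 2 * t" by simp
      with 1 show ?thesis by (simp add: path_concat_def)
    next
      case 2
      then have "?\<phi> t = t + 1/4" by simp
      with 2 show ?thesis by (simp add: path_concat_def algebra_simps)
    next
      case 3
      then have "?\<phi> t = t / 2 + 1/2" by simp
      with 3 show ?thesis by (simp add: path_concat_def algebra_simps)
    qed
  qed
  moreover have "homotopic_rel_ends X (?k \<circ> ?\<phi>) (?k \<circ> id)"
    by (rule reparametrizations_homotopic[OF k])
      (auto simp: path_def path_image_def intro!: continuous_intros)
  ultimately show ?thesis by simp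
qed

lemma path_concat_const_left:
  assumes "pathin X f"
  shows "homotopic_rel_ends X (path_concat (\<lambda>_. f 0) f) f"
proof -
  let ?\<phi> = "\<lambda>t::real. max 0 (2 * t - 1)"
  have "path_concat (\<lambda>_. f 0) f = f \<circ> ?\<phi>"
    by (auto simp: path_concat_def fun_eq_iff max_def intro!: arg_cong[of _ _ f])
  moreover have "homotopic_rel_ends X (f \<circ> ?\<phi>) (f \<circ> id)"
    by (rule reparametrizations_homotopic[OF assms])
      (auto simp: path_def path_image_def intro!: continuous_intros)
  ultimately show ?thesis by simp
qed

text \<open>
  Going back and then forth along \<open>f\<close> is \<open>f\<close> reparametrized by a map that starts and ends
  at \<open>1\<close>.
\<close>

lemma path_concat_reverse_left:
  assumes "pathin X f"
  shows "homotopic_rel_ends X (path_concat (path_reverse f) f) (\<lambda>_. f 1)"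
proof -
  let ?\<phi> = "\<lambda>t::real. \<bar>1 - 2 * t\<bar>"
  have "path_concat (path_reverse f) f = f \<circ> ?\<phi>"
    by (auto simp: path_concat_def fun_eq_iff)
  moreover have "homotopic_rel_ends X (f \<circ> ?\<phi>) (f \<circ> (\<lambda>_. 1))"
    by (rule reparametrizations_homotopic[OF assms])
      (auto simp: path_def path_image_def intro!: continuous_intros)
  ultimately show ?thesis by (simp add: o_def)
qed

lemma loop_at_path_concat: "loop_at X x f \<Longrightarrow> loop_at X x g \<Longrightarrow> loop_at X x (path_concat f g)"
  using pathin_path_concat[of X f g] by (auto simp: loop_at_def path_concat_def)

lemma loop_at_path_reverse: "loop_at X x f \<Longrightarrow> loop_at X x (path_reverse f)"
  using pathin_path_reverse[of X f] by (auto simp: loop_at_def)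

text \<open>
  The union that defines the product consists of copies of one class, by compatibility of
  concatenation with homotopy, and it is not empty since the two loops represent their own classes.
\<close>

lemma mult_path_class:
  assumes "loop_at X x f" "loop_at X x g"
  shows "path_class X f \<otimes>\<^bsub>fundamental_group X x\<^esub> path_class X g = path_class X (path_concat f g)"
proof -
  have fg: "pathin X f" "pathin X g" "f 1 = g 0"
    using assms by (auto simp: loop_at_def)
  have eq: "path_class X (path_concat f' g') = path_class X (path_concat f g)"
    if "f' \<in> path_class X f" "g' \<in> path_class X g" for f' g'
  proof -
    have "homotopic_rel_ends X (path_concat f g) (path_concat f' g')"
      using that by (intro homotopic_rel_ends_path_concat fg(3)) (simp_all add: path_class_def)
    then show ?thesis
      using path_class_eq_iff[OF pathin_path_concat[OF fg]] by blast
  qed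
  have "f \<in> path_class X f" "g \<in> path_class X g"
    by (simp_all add: path_class_def homotopic_rel_ends_refl fg(1,2))
  then have "(\<Union>f'\<in>path_class X f. \<Union>g'\<in>path_class X g. path_class X (path_concat f' g'))
      = path_class X (path_concat f g)"
    by (intro equalityI UN_least equalityD1[OF eq]) blast+
  then show ?thesis
    by (simp add: fundamental_group_def)
qed

lemma group_fundamental_group:
  assumes "x \<in> topspace X"
  shows "group (fundamental_group X x)"
proof (rule groupI)
  let ?G = "fundamental_group X x"
  have carrier: "a \<in> carrier ?G \<longleftrightarrow> (\<exists>f. loop_at X x f \<and> a = path_class X f)" for a
    by (auto simp: fundamental_group_def)
  have one: "\<one>\<^bsub>?G\<^esub> = path_class X (\<lambda>_. x)"
    by (simp add: fundamental_group_def)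
  have const: "loop_at X x (\<lambda>_. x)"
    using assms by (simp add: loop_at_def)
  show "\<one>\<^bsub>?G\<^esub> \<in> carrier ?G"
    using one const carrier by blast
  show "a \<otimes>\<^bsub>?G\<^esub> b \<in> carrier ?G" if "a \<in> carrier ?G" "b \<in> carrier ?G" for a b
    using that mult_path_class loop_at_path_concat carrier by metis
  show "a \<otimes>\<^bsub>?G\<^esub> b \<otimes>\<^bsub>?G\<^esub> c = a \<otimes>\<^bsub>?G\<^esub> (b \<otimes>\<^bsub>?G\<^esub> c)"
    if abc: "a \<in> carrier ?G" "b \<in> carrier ?G" "c \<in> carrier ?G" for a b c
  proof -
    obtain f g h where l: "loop_at X x f" "loop_at X x g" "loop_at X x h"
      and eq: "a = path_class X f" "b = path_class X g" "c = path_class X h"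
      using abc carrier by metis
    have "homotopic_rel_ends X (path_concat (path_concat f g) h) (path_concat f (path_concat g h))"
      using l by (intro path_concat_assoc) (auto simp: loop_at_def)
    then show ?thesis
      using l eq by (simp add: mult_path_class loop_at_path_concat path_class_eq_iff
          homotopic_rel_ends_imp(1))
  qed
  show "\<one>\<^bsub>?G\<^esub> \<otimes>\<^bsub>?G\<^esub> a = a" if a: "a \<in> carrier ?G" for a
  proof -
    obtain f where l: "loop_at X x f" and eq: "a = path_class X f"
      using a carrier by metis
    have "homotopic_rel_ends X (path_concat (\<lambda>_. x) f) f"
      using path_concat_const_left[of X f] l by (auto simp: loop_at_def)
    then show ?thesis
      using l eq const one by (simp add: mult_path_class path_class_eq_iff homotopic_rel_ends_imp(1))
  qed
  show "\<exists>b\<in>carrier ?G. b \<otimes>\<^bsub>?G\<^esub> a = \<one>\<^bsub>?G\<^esub>" if a: "a \<in> carrier ?G" for a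
  proof -
    obtain f where l: "loop_at X x f" and eq: "a = path_class X f"
      using a carrier by metis
    have "homotopic_rel_ends X (path_concat (path_reverse f) f) (\<lambda>_. x)"
      using path_concat_reverse_left[of X f] l by (auto simp: loop_at_def)
    then have "path_class X (path_reverse f) \<otimes>\<^bsub>?G\<^esub> a = \<one>\<^bsub>?G\<^esub>"
      using l eq one mult_path_class[OF loop_at_path_reverse[OF l] l]
      by (simp add: path_class_eq_iff homotopic_rel_ends_imp(1))
    then show ?thesis
      using carrier loop_at_path_reverse[OF l] by blast
  qed
qed

lemma inv_path_class:
  assumes "loop_at X x f"
  shows "inv\<^bsub>fundamental_group X x\<^esub> path_class X f = path_class X (path_reverse f)"
proof (rule group.inv_equality)
  have x: "x \<in> topspace X"
    using assms path_start_in_topspace by (auto simp: loop_at_def)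
  show "group (fundamental_group X x)"
    by (rule group_fundamental_group[OF x])
  have "homotopic_rel_ends X (path_concat (path_reverse f) f) (\<lambda>_. x)"
    using path_concat_reverse_left[of X f] assms by (auto simp: loop_at_def)
  then have "path_class X (path_concat (path_reverse f) f) = path_class X (\<lambda>_. x)"
    by (simp add: path_class_eq_iff homotopic_rel_ends_imp(1))
  then show "path_class X (path_reverse f) \<otimes>\<^bsub>fundamental_group X x\<^esub> path_class X f
      = \<one>\<^bsub>fundamental_group X x\<^esub>"
    using mult_path_class[OF loop_at_path_reverse[OF assms] assms]
    by (simp add: fundamental_group_def)
qed (use assms loop_at_path_reverse[OF assms] in \<open>auto simp: fundamental_group_def\<close>)

section \<open>Closeness in terms of finitely many constraints\<close>

lemma strict_partition_mono:
  fixes t :: "nat \<Rightarrow> real"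
  assumes "\<forall>i\<in>{1..n}. t (i - 1) < t i" "i \<le> j" "j \<le> n"
  shows "t i \<le> t j"
  using assms(2,3)
proof (induction j rule: dec_induct)
  case (step m)
  with assms(1) have "t (Suc m - 1) < t (Suc m)"
    by (intro bspec[OF assms(1)]) auto
  with step show ?case by simp
qed simp

text \<open>
  The partition lists \<open>S\<close> in increasing order. The last conclusion says that a point outside \<open>S\<close>
  falls strictly between two neighbours in this list.
\<close>

lemma strict_partition_enumerating:
  fixes S :: "real set"
  assumes "finite S" "0 \<in> S" "1 \<in> S" "S \<subseteq> {0..1}"
  obtains n :: nat and t :: "nat \<Rightarrow> real"
  where "t 0 = 0" "t n = 1" "\<forall>i\<in>{1..n}. t (i - 1) < t i" "t ` {0..n} = S"
    "\<And>u. u \<in> {0..1} - S \<Longrightarrow> \<exists>i\<in>{1..n}. t (i - 1) < u \<and> u < t i \<and> {t (i - 1)<..<t i} \<inter> S = {}"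
proof -
  define xs where "xs = sorted_list_of_set S"
  define n where "n = length xs - 1"
  have set: "set xs = S" and sorted: "sorted_wrt (<) xs"
    using assms(1) by (simp_all add: xs_def)
  have ne: "xs \<noteq> []"
    using set assms(2) by auto
  have less: "xs ! i < xs ! j" if "i < j" "j \<le> n" for i j
    using sorted_wrt_nth_less[OF sorted] that ne by (simp add: n_def)
  have image: "(!) xs ` {0..n} = S"
  proof -
    have "{0..n} = {..<length xs}"
      using ne by (cases xs) (auto simp: n_def)
    moreover have "(!) xs ` {..<length xs} = set xs"
      by (auto simp: set_conv_nth)
    ultimately show ?thesis
      using set by simp
  qed
  have mem: "xs ! i \<in> {0..1}" if "i \<le> n" for i
    using that image assms(4) by force
  have t0: "xs ! 0 = 0"
  proof -
    obtain i where "i \<le> n" "xs ! i = 0"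
      using image assms(2) by (metis atLeastAtMost_iff imageE)
    then show ?thesis
      using less[of 0 i] mem[of 0] by (cases "i = 0") auto
  qed
  have t1: "xs ! n = 1"
  proof -
    obtain i where "i \<le> n" "xs ! i = 1"
      using image assms(3) by (metis atLeastAtMost_iff imageE)
    then show ?thesis
      using less[of i n] mem[of n] by (cases "i = n") auto
  qed
  show thesis
  proof (rule that[of "(!) xs" n])
    fix u :: real assume u: "u \<in> {0..1} - S"
    define i where "i = (LEAST j. u \<le> xs ! j)"
    have "u \<le> xs ! n"
      using u t1 by simp
    then have i: "u \<le> xs ! i" "i \<le> n"
      unfolding i_def by (rule LeastI, rule Least_le)
    have "u \<noteq> xs ! i"
      using u image i(2) by auto
    have "u \<noteq> 0"
      using u assms(2) by auto
    then have "i \<noteq> 0"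
      using i t0 u by (metis DiffD1 atLeastAtMost_iff order_antisym)
    then have "xs ! (i - 1) < u"
      using not_less_Least[of "i - 1" "\<lambda>j. u \<le> xs ! j"] by (simp add: i_def)
    moreover have "{xs ! (i - 1)<..<xs ! i} \<inter> S = {}"
    proof (rule equals0I)
      fix s assume s: "s \<in> {xs ! (i - 1)<..<xs ! i} \<inter> S"
      then obtain j where j: "j \<le> n" "s = xs ! j"
        using image by (metis IntD2 atLeastAtMost_iff imageE)
      consider "j < i - 1" | "j = i - 1" | "j = i" | "j > i" by linarith
      then show False
      proof cases
        case 1
        then have "xs ! j < xs ! (i - 1)"
          using i(2) by (intro less) auto
        then show False using s j by simp
      qed (use s j less[of i j] in auto)
    qed
    ultimately show "\<exists>i\<in>{1..n}. xs ! (i - 1) < u \<and> u < xs ! i \<and> {xs ! (i - 1)<..<xs ! i} \<inter> S = {}"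
      using i \<open>i \<noteq> 0\<close> \<open>u \<noteq> xs ! i\<close> by (intro bexI[of _ i]) auto
  qed (use t0 t1 less image in auto)
qed

text \<open>
  A triple \<open>(a, b, U)\<close> asks a path to stay in \<open>U\<close> from time \<open>a\<close> to time \<open>b\<close>. The intersection with
  the unit interval lets \<open>a\<close> and \<open>b\<close> be arbitrary reals, so that an affine change of time acts on
  triples without any clipping.
\<close>

definition obeys :: "(real \<Rightarrow> 'a) \<Rightarrow> (real \<times> real \<times> 'a set) set \<Rightarrow> bool"
  where "obeys g C \<longleftrightarrow> (\<forall>(a, b, U)\<in>C. g ` ({a..b} \<inter> {0..1}) \<subseteq> U)"

lemma obeysD: "obeys g C \<Longrightarrow> (a, b, U) \<in> C \<Longrightarrow> g ` ({a..b} \<inter> {0..1}) \<subseteq> U"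
  unfolding obeys_def by blast

text \<open>
  A partition with open sets is a special family of constraints. Conversely, take as partition points
  all prescribed times and all end points of constraint intervals, and give each piece the
  intersection of the open sets whose interval covers it, which is open because there are only
  finitely many. At a partition point the path agrees with \<open>g\<close>, which satisfies the constraints;
  at any other time every active constraint covers the whole surrounding piece.
\<close>

lemma homotopically_close_iff_constraints:
  "homotopically_close X f g \<longleftrightarrow>
    pathin X f \<and> pathin X g \<and> f 0 = g 0 \<and> f 1 = g 1 \<and>
    (\<forall>P C. finite P \<and> finite C \<and> (\<forall>(a, b, U)\<in>C. openin X U) \<and> obeys g C \<longrightarrow>
      (\<exists>\<gamma>. homotopic_rel_ends X \<gamma> f \<and> obeys \<gamma> C \<and> (\<forall>p\<in>P \<inter> {0..1}. \<gamma> p = g p)))"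
    (is "_ \<longleftrightarrow> ?p1 \<and> ?p2 \<and> ?p3 \<and> ?p4 \<and> ?flexible")
proof -
  have flex: ?flexible if close: "homotopically_close X f g"
  proof (intro allI impI)
    fix P :: "real set" and C :: "(real \<times> real \<times> 'a set) set"
    assume PC: "finite P \<and> finite C \<and> (\<forall>(a, b, U)\<in>C. openin X U) \<and> obeys g C"
    define S where "S = {0, 1} \<union> (P \<union> fst ` C \<union> (fst \<circ> snd) ` C) \<inter> {0..1}"
    have S: "finite S" "0 \<in> S" "1 \<in> S" "S \<subseteq> {0..1}"
      using PC by (auto simp: S_def)
    obtain n :: nat and t :: "nat \<Rightarrow> real" where t: "t 0 = 0" "t n = 1"
        "\<forall>i\<in>{1..n}. t (i - 1) < t i" "t ` {0..n} = S"
      and gap: "\<And>u. u \<in> {0..1} - S \<Longrightarrow>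
        \<exists>i\<in>{1..n}. t (i - 1) < u \<and> u < t i \<and> {t (i - 1)<..<t i} \<inter> S = {}"
      using strict_partition_enumerating[OF S] by metis
    have tS: "t i \<in> S" if "i \<le> n" for i
      using t(4) that by auto
    define F where "F i = {U. \<exists>a b. (a, b, U) \<in> C \<and> {t (i - 1)..t i} \<subseteq> {a..b}}" for i
    define W where "W i = topspace X \<inter> \<Inter>(F i)" for i
    have F: "F i \<subseteq> (snd \<circ> snd) ` C" for i
      by (force simp: F_def)
    have openW: "openin X (W i)" for i
      unfolding W_def
    proof (rule openin_Int_Inter)
      show "finite (F i)"
        using F PC by (meson finite_imageI finite_subset)
      show "openin X U" if "U \<in> F i" for U
        using that PC by (auto simp: F_def)
    qed auto
    have gW: "g ` {t (i - 1)..t i} \<subseteq> W i" if i: "i \<in> {1..n}" for i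
    proof -
      have sub: "{t (i - 1)..t i} \<subseteq> {0..1}"
        using tS[of i] tS[of "i - 1"] i S(4) by fastforce
      have "g ` {t (i - 1)..t i} \<subseteq> topspace X"
        using close sub path_image_subset_topspace[of X g] by (auto simp: homotopically_close_def)
      moreover have "g ` {t (i - 1)..t i} \<subseteq> U" if "U \<in> F i" for U
      proof -
        obtain a b where ab: "(a, b, U) \<in> C" "{t (i - 1)..t i} \<subseteq> {a..b}"
          using \<open>U \<in> F i\<close> unfolding F_def by blast
        then have "g ` ({a..b} \<inter> {0..1}) \<subseteq> U"
          using PC obeysD by blast
        then show ?thesis using ab(2) sub by blast
      qed
      ultimately show ?thesis by (auto simp: W_def)
    qed
    have "\<exists>\<gamma>. pathin X \<gamma> \<and> (\<forall>i\<in>{1..n}. \<gamma> ` {t (i - 1)..t i} \<subseteq> W i) \<and>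
              (\<forall>i\<in>{0..n}. \<gamma> (t i) = g (t i)) \<and> homotopic_rel_ends X \<gamma> f"
      using close t openW gW unfolding homotopically_close_def by blast
    then obtain \<gamma> where \<gamma>: "\<And>i. i \<in> {1..n} \<Longrightarrow> \<gamma> ` {t (i - 1)..t i} \<subseteq> W i"
        "\<And>i. i \<in> {0..n} \<Longrightarrow> \<gamma> (t i) = g (t i)" "homotopic_rel_ends X \<gamma> f"
      by blast
    have agree: "\<gamma> s = g s" if "s \<in> S" for s
      using that \<gamma>(2) t(4) by blast
    have "obeys \<gamma> C"
      unfolding obeys_def
    proof (clarify)
      fix a b U u
      assume C: "(a, b, U) \<in> C" and u: "u \<in> {a..b}" "u \<in> {0..1}"
      show "\<gamma> u \<in> U"
      proof (cases "u \<in> S")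
        case True
        have "g ` ({a..b} \<inter> {0..1}) \<subseteq> U"
          using PC C obeysD by blast
        then show ?thesis
          using agree[OF True] u by auto
      next
        case False
        then obtain i where i: "i \<in> {1..n}" "t (i - 1) < u" "u < t i"
            and disj: "{t (i - 1)<..<t i} \<inter> S = {}"
          using gap u by blast
        then have "i - 1 \<le> n" "i \<le> n"
          by auto
        then have bounds: "t (i - 1) \<in> {0..1}" "t i \<in> {0..1}"
          using tS S(4) by blast+
        have aS: "a \<in> S" if "a \<in> {0..1}"
          using that C by (force simp: S_def)
        have bS: "b \<in> S" if "b \<in> {0..1}"
          using that C by (force simp: S_def)
        (* An end point of [a,b] inside the piece would have been made a partition point. *)
        have "a \<le> t (i - 1)"
        proof (rule ccontr)
          assume "\<not> a \<le> t (i - 1)"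
          then have "a \<in> {t (i - 1)<..<t i}" "a \<in> {0..1}"
            using i(3) u bounds by auto
          then show False using aS disj by blast
        qed
        moreover have "t i \<le> b"
        proof (rule ccontr)
          assume "\<not> t i \<le> b"
          then have "b \<in> {t (i - 1)<..<t i}" "b \<in> {0..1}"
            using i(2) u bounds by auto
          then show False using bS disj by blast
        qed
        ultimately have "U \<in> F i"
          using C by (auto simp: F_def)
        moreover have "\<gamma> u \<in> W i"
          using \<gamma>(1)[OF i(1)] i by auto
        ultimately show ?thesis by (auto simp: W_def)
      qed
    qed
    moreover have "\<forall>p\<in>P \<inter> {0..1}. \<gamma> p = g p"
      using agree by (auto simp: S_def)
    ultimately show "\<exists>\<gamma>. homotopic_rel_ends X \<gamma> f \<and> obeys \<gamma> C \<and> (\<forall>p\<in>P \<inter> {0..1}. \<gamma> p = g p)"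
      using \<gamma>(3) by blast
  qed
  have close: "homotopically_close X f g" if paths: ?p1 ?p2 ?p3 ?p4 and flexible: ?flexible
    unfolding homotopically_close_def
  proof (intro conjI allI impI)
    fix n :: nat and t :: "nat \<Rightarrow> real" and U :: "nat \<Rightarrow> 'a set"
    assume t: "t 0 = 0 \<and> t n = 1 \<and> (\<forall>i\<in>{1..n}. t (i - 1) < t i) \<and>
       (\<forall>i\<in>{1..n}. openin X (U i) \<and> g ` {t (i - 1)..t i} \<subseteq> U i)"
    let ?C = "(\<lambda>i. (t (i - 1), t i, U i)) ` {1..n}"
    have t01: "t i \<in> {0..1}" if "i \<le> n" for i
      using strict_partition_mono[of n t 0 i] strict_partition_mono[of n t i n] t that by auto
    have sub: "{t (i - 1)..t i} \<inter> {0..1} = {t (i - 1)..t i}" if "i \<in> {1..n}" for i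
      using t01[of i] t01[of "i - 1"] that by auto
    have C: "obeys k ?C \<longleftrightarrow> (\<forall>i\<in>{1..n}. k ` {t (i - 1)..t i} \<subseteq> U i)" for k
      using sub by (simp only: obeys_def ball_simps case_prod_conv cong: ball_cong)
    have "\<exists>\<gamma>. homotopic_rel_ends X \<gamma> f \<and> obeys \<gamma> ?C \<and> (\<forall>p\<in>t ` {0..n} \<inter> {0..1}. \<gamma> p = g p)"
      by (rule flexible[rule_format]) (use t in \<open>auto simp only: C intro: finite_imageI\<close>)
    then obtain \<gamma> where "homotopic_rel_ends X \<gamma> f" "obeys \<gamma> ?C" "\<forall>p\<in>t ` {0..n} \<inter> {0..1}. \<gamma> p = g p"
      by blast
    moreover from this have "\<forall>i\<in>{0..n}. \<gamma> (t i) = g (t i)"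
      using t01 by (metis IntI atLeastAtMost_iff imageI)
    ultimately show "\<exists>\<gamma>. pathin X \<gamma> \<and> (\<forall>i\<in>{1..n}. \<gamma> ` {t (i - 1)..t i} \<subseteq> U i) \<and>
              (\<forall>i\<in>{0..n}. \<gamma> (t i) = g (t i)) \<and> homotopic_rel_ends X \<gamma> f"
      unfolding C using homotopic_rel_ends_imp(1) by blast
  qed (use paths in auto)
  show ?thesis
  proof
    assume fg: "homotopically_close X f g"
    then have "pathin X f" "pathin X g" "f 0 = g 0" "f 1 = g 1"
      by (simp_all add: homotopically_close_def)
    with flex[OF fg] show "?p1 \<and> ?p2 \<and> ?p3 \<and> ?p4 \<and> ?flexible"
      by blast
  qed (use close in blast)
qed

section \<open>Closeness is compatible with the path operations\<close>

lemma homotopically_close_refl: "pathin X f \<Longrightarrow> homotopically_close X f f"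
  unfolding homotopically_close_def using homotopic_rel_ends_refl by blast

lemma homotopically_close_path_reverse:
  assumes "homotopically_close X f g"
  shows "homotopically_close X (path_reverse f) (path_reverse g)"
  unfolding homotopically_close_iff_constraints[of X "path_reverse f"]
proof (intro conjI allI impI)
  fix P :: "real set" and C :: "(real \<times> real \<times> 'a set) set"
  assume PC: "finite P \<and> finite C \<and> (\<forall>(a, b, U)\<in>C. openin X U) \<and> obeys (path_reverse g) C"
  let ?r = "\<lambda>t::real. 1 - t"
  let ?C = "(\<lambda>(a, b, U). (1 - b, 1 - a, U)) ` C"
  have image: "k ` ({1 - b..1 - a} \<inter> {0..1}) = path_reverse k ` ({a..b} \<inter> {0..1})"
    for k :: "real \<Rightarrow> 'a" and a b
    by (force simp: image_iff intro: bexI[of _ "1 - _"])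
  have C: "obeys k ?C \<longleftrightarrow> obeys (path_reverse k) C" for k
    by (simp only: obeys_def ball_simps image case_prod_unfold fst_conv snd_conv)
  have "\<exists>\<gamma>. homotopic_rel_ends X \<gamma> f \<and> obeys \<gamma> ?C \<and> (\<forall>p\<in>?r ` P \<inter> {0..1}. \<gamma> p = g p)"
    using assms[unfolded homotopically_close_iff_constraints] PC C
    by (elim conjE allE[of _ "?r ` P"] allE[of _ ?C]) auto
  then obtain \<gamma> where "homotopic_rel_ends X \<gamma> f" "obeys \<gamma> ?C" "\<forall>p\<in>?r ` P \<inter> {0..1}. \<gamma> p = g p"
    by blast
  then show "\<exists>\<gamma>. homotopic_rel_ends X \<gamma> (path_reverse f) \<and> obeys \<gamma> C \<and>
      (\<forall>p\<in>P \<inter> {0..1}. \<gamma> p = path_reverse g p)"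
    using C homotopic_rel_ends_path_reverse by (intro exI[of _ "path_reverse \<gamma>"]) auto
qed (use assms pathin_path_reverse in \<open>auto simp: homotopically_close_def\<close>)

text \<open>
  A path satisfies a constraint if and only if its first half satisfies the pullback along
  \<open>t \<mapsto> 2 t\<close> and its second half the pullback along \<open>t \<mapsto> 2 t - 1\<close>. So paths that approximate
  \<open>f'\<close> and \<open>g'\<close> under the pulled-back constraints concatenate to one that approximates
  \<open>path_concat f' g'\<close> under the given ones.
\<close>

lemma homotopically_close_path_concat:
  assumes f: "homotopically_close X f f'" and g: "homotopically_close X g g'" and fg: "f 1 = g 0"
  shows "homotopically_close X (path_concat f g) (path_concat f' g')"
  unfolding homotopically_close_iff_constraints[of X "path_concat f g"]
proof (intro conjI allI impI)
  fix P :: "real set" and C :: "(real \<times> real \<times> 'a set) set"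
  assume PC: "finite P \<and> finite C \<and> (\<forall>(a, b, U)\<in>C. openin X U) \<and> obeys (path_concat f' g') C"
  let ?l = "\<lambda>t::real. 2 * t" and ?r = "\<lambda>t::real. 2 * t - 1"
  let ?L = "(\<lambda>(a, b, U). (?l a, ?l b, U)) ` C" and ?R = "(\<lambda>(a, b, U). (?r a, ?r b, U)) ` C"
  have ends: "f' 1 = g' 0"
    using f g fg by (auto simp: homotopically_close_def)
  have image: "path_concat k m ` ({a..b} \<inter> {0..1})
      = k ` ({?l a..?l b} \<inter> {0..1}) \<union> m ` ({?r a..?r b} \<inter> {0..1})"
    if km: "k 1 = m 0" for k m :: "real \<Rightarrow> 'a" and a b
  proof -
    have left: "k u = path_concat k m (u / 2)" if "u \<le> 1" for u
      using that by (simp add: path_concat_def)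
    have right: "m u = path_concat k m ((u + 1) / 2)" if "u \<ge> 0" for u
      using that km by (cases "u = 0") (simp_all add: path_concat_def add_divide_distrib)
    show ?thesis
    proof (intro equalityI subsetI)
      fix y assume "y \<in> path_concat k m ` ({a..b} \<inter> {0..1})"
      then show "y \<in> k ` ({?l a..?l b} \<inter> {0..1}) \<union> m ` ({?r a..?r b} \<inter> {0..1})"
        by (force simp: path_concat_def split: if_splits)
    next
      fix y assume "y \<in> k ` ({?l a..?l b} \<inter> {0..1}) \<union> m ` ({?r a..?r b} \<inter> {0..1})"
      then show "y \<in> path_concat k m ` ({a..b} \<inter> {0..1})"
      proof (elim UnE imageE)
        fix u assume "y = k u" "u \<in> {?l a..?l b} \<inter> {0..1}"
        then show ?thesis using left by (intro image_eqI[of _ _ "u / 2"]) auto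
      next
        fix u assume "y = m u" "u \<in> {?r a..?r b} \<inter> {0..1}"
        then show ?thesis using right by (intro image_eqI[of _ _ "(u + 1) / 2"]) auto
      qed
    qed
  qed
  have C: "obeys (path_concat k m) C \<longleftrightarrow> obeys k ?L \<and> obeys m ?R" if "k 1 = m 0"
    for k m :: "real \<Rightarrow> 'a"
    unfolding obeys_def ball_simps
    by (simp only: image[of k m, OF that] case_prod_unfold fst_conv snd_conv Un_subset_iff ball_conj_distrib)
  have LR: "obeys f' ?L" "obeys g' ?R"
    using PC C[of f' g', OF ends] by simp_all
  have "\<exists>\<gamma>. homotopic_rel_ends X \<gamma> f \<and> obeys \<gamma> ?L \<and> (\<forall>p\<in>?l ` P \<inter> {0..1}. \<gamma> p = f' p)"
    using f[unfolded homotopically_close_iff_constraints] PC LR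
    by (elim conjE allE[of _ "?l ` P"] allE[of _ ?L]) auto
  then obtain \<gamma> where \<gamma>: "homotopic_rel_ends X \<gamma> f" "obeys \<gamma> ?L" "\<And>p. p \<in> ?l ` P \<inter> {0..1} \<Longrightarrow> \<gamma> p = f' p"
    by blast
  have "\<exists>\<gamma>. homotopic_rel_ends X \<gamma> g \<and> obeys \<gamma> ?R \<and> (\<forall>p\<in>?r ` P \<inter> {0..1}. \<gamma> p = g' p)"
    using g[unfolded homotopically_close_iff_constraints] PC LR
    by (elim conjE allE[of _ "?r ` P"] allE[of _ ?R]) auto
  then obtain \<delta> where \<delta>: "homotopic_rel_ends X \<delta> g" "obeys \<delta> ?R" "\<And>p. p \<in> ?r ` P \<inter> {0..1} \<Longrightarrow> \<delta> p = g' p"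
    by blast
  have \<gamma>\<delta>: "\<gamma> 1 = \<delta> 0"
    using homotopic_rel_ends_imp[OF \<gamma>(1)] homotopic_rel_ends_imp[OF \<delta>(1)] fg by simp
  have "path_concat \<gamma> \<delta> p = path_concat f' g' p" if "p \<in> P \<inter> {0..1}" for p
    using that \<gamma>(3)[of "2 * p"] \<delta>(3)[of "2 * p - 1"] by (auto simp: path_concat_def)
  then show "\<exists>\<eta>. homotopic_rel_ends X \<eta> (path_concat f g) \<and> obeys \<eta> C \<and>
      (\<forall>p\<in>P \<inter> {0..1}. \<eta> p = path_concat f' g' p)"
    using C[of \<gamma> \<delta>, OF \<gamma>\<delta>] \<gamma> \<delta> \<gamma>\<delta> homotopic_rel_ends_path_concat by (intro exI[of _ "path_concat \<gamma> \<delta>"]) blast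
qed (use f g fg pathin_path_concat[of X] in \<open>auto simp: homotopically_close_def path_concat_def\<close>)

section \<open>Classes close to a subgroup\<close>

lemma qs_subsetI:
  assumes "loop_at X x f" "loop_at X x h" "path_class X h \<in> H" "homotopically_close X f h"
  shows "path_class X f \<in> qs_subset X x H"
  using assms by (auto simp: qs_subset_def)

lemma subgroup_qs_subset:
  assumes x: "x \<in> topspace X" and H: "subgroup H (fundamental_group X x)"
  shows "subgroup (qs_subset X x H) (fundamental_group X x)"
proof (rule group.subgroupI)
  let ?G = "fundamental_group X x"
  show G: "group ?G"
    by (rule group_fundamental_group[OF x])
  show "qs_subset X x H \<subseteq> carrier ?G"
    by (auto simp: qs_subset_def fundamental_group_def)
  have "loop_at X x (\<lambda>_. x)"
    using x by (simp add: loop_at_def)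
  moreover have "path_class X (\<lambda>_. x) \<in> H"
    using subgroup.one_closed[OF H] by (simp add: fundamental_group_def)
  ultimately show "qs_subset X x H \<noteq> {}"
    using qs_subsetI homotopically_close_refl loop_at_def by (metis empty_iff)
  show "inv\<^bsub>?G\<^esub> a \<in> qs_subset X x H" if "a \<in> qs_subset X x H" for a
  proof -
    obtain f h where f: "loop_at X x f" "a = path_class X f"
      and h: "loop_at X x h" "path_class X h \<in> H" "homotopically_close X f h"
      using \<open>a \<in> _\<close> by (auto simp: qs_subset_def)
    have "path_class X (path_reverse h) \<in> H"
      using subgroup.m_inv_closed[OF H h(2)] inv_path_class[OF h(1)] by simp
    then have "path_class X (path_reverse f) \<in> qs_subset X x H"
      using f h by (intro qs_subsetI[of X x _ "path_reverse h"])
        (auto intro: loop_at_path_reverse homotopically_close_path_reverse)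
    then show ?thesis
      using f by (simp add: inv_path_class)
  qed
  show "a \<otimes>\<^bsub>?G\<^esub> b \<in> qs_subset X x H" if ab: "a \<in> qs_subset X x H" "b \<in> qs_subset X x H" for a b
  proof -
    obtain f h where f: "loop_at X x f" "a = path_class X f"
      and h: "loop_at X x h" "path_class X h \<in> H" "homotopically_close X f h"
      using ab(1) by (auto simp: qs_subset_def)
    obtain f' h' where f': "loop_at X x f'" "b = path_class X f'"
      and h': "loop_at X x h'" "path_class X h' \<in> H" "homotopically_close X f' h'"
      using ab(2) by (auto simp: qs_subset_def)
    have "path_class X (path_concat h h') \<in> H"
      using subgroup.m_closed[OF H h(2) h'(2)] mult_path_class[OF h(1) h'(1)] by simp
    moreover have "f 1 = f' 0"
      using f f' by (simp add: loop_at_def)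
    ultimately have "path_class X (path_concat f f') \<in> qs_subset X x H"
      using f h f' h' by (intro qs_subsetI[of X x _ "path_concat h h'"])
        (auto intro: loop_at_path_concat homotopically_close_path_concat)
    then show ?thesis
      using f f' by (simp add: mult_path_class)
  qed
qed

text \<open>
  The conjugating loop is close to itself, so conjugates of close loops are close.
\<close>

lemma normal_qs_subset:
  assumes x: "x \<in> topspace X" and H: "H \<lhd> fundamental_group X x"
  shows "qs_subset X x H \<lhd> fundamental_group X x"
proof (rule group.normal_invI)
  let ?G = "fundamental_group X x"
  show G: "group ?G"
    by (rule group_fundamental_group[OF x])
  show "subgroup (qs_subset X x H) ?G"
    by (rule subgroup_qs_subset[OF x normal_imp_subgroup[OF H]])
  fix c a assume "c \<in> carrier ?G" and "a \<in> qs_subset X x H"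
  obtain k where k: "loop_at X x k" "c = path_class X k"
    using \<open>c \<in> _\<close> by (auto simp: fundamental_group_def)
  obtain f h where f: "loop_at X x f" "a = path_class X f"
    and h: "loop_at X x h" "path_class X h \<in> H" "homotopically_close X f h"
    using \<open>a \<in> _\<close> by (auto simp: qs_subset_def)
  let ?conj = "\<lambda>m. path_concat (path_concat k m) (path_reverse k)"
  have conj: "c \<otimes>\<^bsub>?G\<^esub> path_class X m \<otimes>\<^bsub>?G\<^esub> inv\<^bsub>?G\<^esub> c = path_class X (?conj m)"
    "loop_at X x (?conj m)" if "loop_at X x m" for m
    using k that by (simp_all only: inv_path_class mult_path_class loop_at_path_concat loop_at_path_reverse)
  have "path_class X (?conj h) \<in> H"
    using normal.inv_op_closed2[OF H \<open>c \<in> _\<close> h(2)] conj(1)[OF h(1)] by simp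
  moreover have "homotopically_close X (?conj f) (?conj h)"
    using k f h by (intro homotopically_close_path_concat homotopically_close_refl pathin_path_reverse)
      (auto simp: loop_at_def path_concat_def)
  ultimately show "c \<otimes>\<^bsub>?G\<^esub> a \<otimes>\<^bsub>?G\<^esub> inv\<^bsub>?G\<^esub> c \<in> qs_subset X x H"
    using conj f h qs_subsetI by metis
qed

theorem theorem3p2:
  fixes X :: "'a topology" and x :: 'a and H :: "(real \<Rightarrow> 'a) set set"
  assumes "path_connected_space X"
    and "x \<in> topspace X"
    and "subgroup H (fundamental_group X x)"
  shows "subgroup (qs_subset X x H) (fundamental_group X x) \<and>
    (H \<lhd> fundamental_group X x \<longrightarrow> qs_subset X x H \<lhd> fundamental_group X x) \<and>
    quasi_small_loop_group X x \<lhd> fundamental_group X x"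
proof (intro conjI impI)
  show "subgroup (qs_subset X x H) (fundamental_group X x)"
    by (rule subgroup_qs_subset[OF assms(2,3)])
  show "qs_subset X x H \<lhd> fundamental_group X x" if "H \<lhd> fundamental_group X x"
    by (rule normal_qs_subset[OF assms(2) that])
  have "{path_class X (\<lambda>_. x)} \<lhd> fundamental_group X x"
    using group.one_is_normal[OF group_fundamental_group[OF assms(2)]]
    by (simp add: fundamental_group_def)
  then show "quasi_small_loop_group X x \<lhd> fundamental_group X x"
    unfolding quasi_small_loop_group_def by (rule normal_qs_subset[OF assms(2)])
qed

end
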